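(* For all finite subsets $P \subseteq \mathbb{R}^d$, $\operatorname{opx}(n, P, d) = \Theta(\operatorname{ex}(n, M_P, d))$, where the constant in the bound depends on the differences between the consecutive values for each coordinate of $P$.
   Context: Here $d$ is the dimension and $n$ ranges over positive integers (so that $\operatorname{ex}$ is defined). Containment for subsets of $\mathbb{R}^d$: for $P, S \subseteq \mathbb{R}^d$, let $C_i(P)$ and $C_i(S)$ be the sets of all $i$-th coordinates of points of $P$ and $S$. $S$ contains $P$ if there exist functions $f_i : C_i(P) \to C_i(S)$ for $i = 1, \dots, d$ such that (1) for each $i$, $\frac{f_i(x)-f_i(x')}{x-x'} \ge 1$ for all $x > x'$ in $C_i(P)$; (2) $(f_1(x_1), \dots, f_d(x_d)) \in S$ for all $(x_1, \dots, x_d) \in P$. Otherwise $S$ is $P$-free. For real $n > 0$, $\operatorname{opx}(n,P,d)$ is the supremum of the $d$-dimensional Lebesgue measure $\mu_d(S)$ over all open $P$-free subsets $S \subseteq [0,n]^d$. A $d$-dimensional 0-1 matrix $A$ contains a $d$-dimensional 0-1 matrix $B$ if some submatrix of $A$ is either equal to $B$ or can be turned into $B$ by changing some ones to zeroes; otherwise $A$ is $B$-free. $\operatorname{ex}(n, M, d)$ is the maximum possible number of ones in a $d$-dimensional $M$-free 0-1 matrix with all dimensions equal to $n$. For finite $P \subseteq \mathbb{R}^d$, $M_P$ is the $d$-dimensional 0-1 matrix whose $i$-th dimension has length equal to the number of distinct values of the $i$-th coordinate of points of $P$, the indices of the $i$-th dimension corresponding to these values in order, with a one in each entry corresponding to a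 point of $P$ and a zero in each other entry. $f(n) = \Theta(g(n))$ means there are constants $C_1, C_2 > 0$ with $C_1 g(n) \le f(n) \le C_2 g(n)$ for all sufficiently large $n$. *)

theory Defs
  imports "HOL-Analysis.Analysis"
begin

section \<open>Containment and the extremal function for subsets of Euclidean space\<close>

definition coords :: "'d \<Rightarrow> (real ^ 'd) set \<Rightarrow> real set" where
  "coords i P = (\<lambda>x. x $ i) ` P"

definition contains_set :: "(real ^ 'd) set \<Rightarrow> (real ^ 'd) set \<Rightarrow> bool" where
  "contains_set S P \<longleftrightarrow>
    (\<exists>f :: 'd \<Rightarrow> real \<Rightarrow> real.
      (\<forall>i. \<forall>x\<in>coords i P. f i x \<in> coords i S) \<and>
      (\<forall>i. \<forall>x\<in>coords i P. \<forall>x'\<in>coords i P. x > x' \<longrightarrow> (f i x - f i x') / (x - x') \<ge> 1) \<and>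
      (\<forall>x\<in>P. (\<chi> i. f i (x $ i)) \<in> S))"

text \<open>
  The values lie in \<^typ>\<open>ennreal\<close>, so the supremum over the empty family is 0. That case
  occurs only for \<open>P = {}\<close>, which is contained in every set.
\<close>

definition opx :: "real \<Rightarrow> (real ^ 'd::finite) set \<Rightarrow> ennreal" where
  "opx n P = (SUP S \<in> {S. open S \<and> S \<subseteq> cbox 0 (\<chi> i. n) \<and> \<not> contains_set S P}. emeasure lebesgue S)"

section \<open>Multidimensional 0-1 matrices\<close>

text \<open>
  The dimensions are indexed by the type \<open>'d\<close>, and indices in dimension \<open>i\<close> run from 0 to
  \<open>dims A i - 1\<close>. \<^const>\<open>True\<close> stands for a one and \<^const>\<open>False\<close> for a zero. The values of
  \<open>entry A\<close> outside \<open>indices A\<close> are irrelevant.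
\<close>

record 'd matrix01 =
  dims :: "'d \<Rightarrow> nat"
  entry :: "('d \<Rightarrow> nat) \<Rightarrow> bool"

definition indices :: "'d matrix01 \<Rightarrow> ('d \<Rightarrow> nat) set" where
  "indices A = {k. \<forall>i. k i < dims A i}"

definition ones :: "'d matrix01 \<Rightarrow> ('d \<Rightarrow> nat) set" where
  "ones A = {k \<in> indices A. entry A k}"

text \<open>
  A submatrix is given by the increasing enumeration \<open>s i\<close> of the \<open>m i\<close> indices that are kept
  in each dimension \<open>i\<close>.
\<close>

definition is_submatrix :: "'d matrix01 \<Rightarrow> 'd matrix01 \<Rightarrow> bool" where
  "is_submatrix B A \<longleftrightarrow>
    (\<exists>s :: 'd \<Rightarrow> nat \<Rightarrow> nat.
      (\<forall>i. strict_mono_on {..<dims B i} (s i) \<and> s i ` {..<dims B i} \<subseteq> {..<dims A i}) \<and>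
      (\<forall>k\<in>indices B. entry B k \<longleftrightarrow> entry A (\<lambda>i. s i (k i))))"

text \<open>
  \<open>A\<close> equals \<open>B\<close>, or becomes \<open>B\<close> by changing some ones to zeroes.
\<close>

definition reduces_to :: "'d matrix01 \<Rightarrow> 'd matrix01 \<Rightarrow> bool" where
  "reduces_to A B \<longleftrightarrow>
    dims A = dims B \<and>
    (\<forall>k\<in>indices B. (entry A k \<longleftrightarrow> entry B k) \<or> (entry A k \<and> \<not> entry B k))"

definition contains_matrix :: "'d matrix01 \<Rightarrow> 'd matrix01 \<Rightarrow> bool" where
  "contains_matrix A B \<longleftrightarrow> (\<exists>A'. is_submatrix A' A \<and> reduces_to A' B)"

text \<open>
  The set below is bounded by \<open>n ^ CARD('d)\<close>, so \<^const>\<open>Sup\<close> is its maximum. The set is empty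
  when every matrix of that size contains \<open>M\<close>, and then \<^const>\<open>Sup\<close> on \<^typ>\<open>nat\<close> is 0.
\<close>

definition ex :: "nat \<Rightarrow> 'd::finite matrix01 \<Rightarrow> nat" where
  "ex n M = Sup {card (ones A) | A. dims A = (\<lambda>i. n) \<and> \<not> contains_matrix A M}"

section \<open>The matrix of a finite point set\<close>

abbreviation coord_list :: "'d \<Rightarrow> (real ^ 'd) set \<Rightarrow> real list" where
  "coord_list i P \<equiv> sorted_list_of_set (coords i P)"

definition matrix_of :: "(real ^ 'd) set \<Rightarrow> 'd matrix01" where
  "matrix_of P = \<lparr>dims = (\<lambda>i. card (coords i P)),
                  entry = (\<lambda>k. (\<chi> i. coord_list i P ! k i) \<in> P)\<rparr>"

definition gaps :: "(real ^ 'd) set \<Rightarrow> 'd \<Rightarrow> real list" where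
  "gaps P i = map (\<lambda>j. coord_list i P ! Suc j - coord_list i P ! j) [0..<card (coords i P) - 1]"

end

theory Submission
  imports Defs
begin

text \<open>
  Let \<open>\<eta> \<le> 1\<close> be at most every gap of \<open>P\<close> and \<open>\<delta> \<ge> 1\<close> at least every gap.

  Lower bound: replace each one of a matrix that avoids \<open>M\<^sub>P\<close> by an open cube of side \<open>\<eta>\<close>. A copy of
  \<open>P\<close> in the union has distinct coordinates at distance at least \<open>\<eta>\<close>, hence in distinct slabs, so it
  would give a copy of \<open>M\<^sub>P\<close>. The constant is \<open>\<eta>\<^sup>d\<close>.

  Upper bound: for each shift \<open>t\<close> the lattice points \<open>t + \<delta> k\<close> that lie in \<open>S\<close> form a matrix of side
  \<open>n\<close> that avoids \<open>M\<^sub>P\<close>, because coordinates of lattice points expand all differences of \<open>P\<close>. Averaging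
  the number of these points over \<open>t \<in> [0, \<delta>]\<^sup>d\<close> bounds the measure of \<open>S\<close> by \<open>\<delta>\<^sup>d ex(n, M\<^sub>P)\<close>.
\<close>

section \<open>Matrix containment and the extremal function\<close>

text \<open>Changing ones to zeroes is free, so only the ones of \<open>B\<close> constrain the
  selection \<open>s\<close>. The intermediate submatrix can be recovered by reading
  \<open>A\<close> along \<open>s\<close>; the later proofs then deal with index maps alone.\<close>

lemma contains_matrix_iff:
  "contains_matrix A B \<longleftrightarrow>
    (\<exists>s. (\<forall>i. strict_mono_on {..<dims B i} (s i) \<and> s i ` {..<dims B i} \<subseteq> {..<dims A i}) \<and>
         (\<forall>k\<in>ones B. entry A (\<lambda>i. s i (k i))))"
  (is "_ \<longleftrightarrow> (\<exists>s. ?mono s \<and> ?ones s)")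
proof
  assume "contains_matrix A B"
  then obtain A' s where "dims A' = dims B" "?mono s"
    and "\<forall>k\<in>indices A'. entry A' k \<longleftrightarrow> entry A (\<lambda>i. s i (k i))"
    and "\<forall>k\<in>indices B. (entry A' k \<longleftrightarrow> entry B k) \<or> (entry A' k \<and> \<not> entry B k)"
    unfolding contains_matrix_def is_submatrix_def reduces_to_def by auto
  then have "?mono s \<and> ?ones s"
    by (auto simp: ones_def indices_def)
  then show "\<exists>s. ?mono s \<and> ?ones s" by blast
next
  assume "\<exists>s. ?mono s \<and> ?ones s"
  then obtain s where s: "?mono s" "?ones s" by blast
  define A' where "A' = \<lparr>dims = dims B, entry = \<lambda>k. entry A (\<lambda>i. s i (k i))\<rparr>"
  have "is_submatrix A' A"
    unfolding is_submatrix_def by (rule exI[of _ s]) (use s in \<open>auto simp: A'_def\<close>)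
  moreover have "reduces_to A' B"
    using s by (auto simp: reduces_to_def A'_def ones_def)
  ultimately show "contains_matrix A B"
    unfolding contains_matrix_def by blast
qed

lemma finite_box_indices: "finite {k :: 'd::finite \<Rightarrow> nat. \<forall>i. k i < n}"
proof -
  have "{k :: 'd \<Rightarrow> nat. \<forall>i. k i < n} = (\<Pi>\<^sub>E i\<in>UNIV. {..<n})"
    by (auto simp: PiE_def Pi_def)
  then show ?thesis by (simp add: finite_PiE)
qed

lemma ones_subset_box: "dims A = (\<lambda>i. n) \<Longrightarrow> ones A \<subseteq> {k. \<forall>i. k i < n}"
  by (auto simp: ones_def indices_def)

lemma finite_ones: "dims A = (\<lambda>i. n) \<Longrightarrow> finite (ones (A :: 'd::finite matrix01))"
  by (rule finite_subset[OF ones_subset_box finite_box_indices])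

lemma finite_ex_candidates:
  "finite {card (ones A) | A. dims A = (\<lambda>i. n) \<and> \<not> contains_matrix A (M :: 'd::finite matrix01)}"
  by (rule finite_subset[of _ "{..card {k :: 'd \<Rightarrow> nat. \<forall>i. k i < n}}"])
    (auto intro!: card_mono finite_box_indices dest: ones_subset_box)

lemma card_ones_le_ex:
  assumes "dims A = (\<lambda>i. n)" "\<not> contains_matrix A M"
  shows "card (ones A) \<le> ex n M"
  unfolding ex_def
  by (rule cSup_upper) (use assms in \<open>auto intro: bdd_above_finite finite_ex_candidates\<close>)

text \<open>The supremum of the empty set of naturals is 0, so a positive value shows that some
  matrix of this size avoids \<open>M\<close>; the finite nonempty set of counts then has a
  maximum.\<close>

lemma ex_attained:
  assumes "ex n M > 0"
  obtains A where "dims A = (\<lambda>i. n)" "\<not> contains_matrix A M" "card (ones A) = ex n M"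
proof -
  let ?X = "{card (ones A) | A. dims A = (\<lambda>i. n) \<and> \<not> contains_matrix A M}"
  have "?X \<noteq> {}" using assms by (force simp: ex_def Sup_nat_def)
  then have "Max ?X \<in> ?X" by (intro Max_in finite_ex_candidates)
  moreover have "ex n M = Max ?X"
    using \<open>?X \<noteq> {}\<close> unfolding ex_def Sup_nat_def by (rule if_not_P)
  ultimately show thesis using that by auto
qed

section \<open>Sorted coordinates and their gaps\<close>

lemma finite_coords: "finite P \<Longrightarrow> finite (coords i P)"
  by (simp add: coords_def)

lemma coord_list_nth:
  assumes "finite P" "j < card (coords i P)"
  shows "coord_list i P ! j \<in> coords i P"
  by (metis assms finite_coords length_sorted_list_of_set nth_mem set_sorted_list_of_set)

lemma coord_list_nth_less:
  assumes "j < j'" "j' < card (coords i P)"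
  shows "coord_list i P ! j < coord_list i P ! j'"
  using strict_sorted_list_of_set[of "coords i P"] assms by (simp add: sorted_wrt_iff_nth_less)

lemma coord_list_inv:
  assumes "finite P" "x \<in> coords i P"
  defines "j \<equiv> inv_into {..<card (coords i P)} ((!) (coord_list i P)) x"
  shows "j < card (coords i P)" "coord_list i P ! j = x"
proof -
  have "x \<in> (!) (coord_list i P) ` {..<card (coords i P)}"
    using assms(1,2) in_set_conv_nth[of x "coord_list i P"] by (auto simp: finite_coords)
  from inv_into_into[OF this] f_inv_into_f[OF this]
  show "j < card (coords i P)" "coord_list i P ! j = x"
    by (simp_all add: j_def)
qed

lemma coord_list_diff_in_gaps:
  assumes "Suc j < card (coords i P)"
  shows "coord_list i P ! Suc j - coord_list i P ! j \<in> set (gaps P i)"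
  using assms by (auto simp: gaps_def)

lemma gaps_pos:
  assumes "d \<in> set (gaps P i)"
  shows "d > 0"
  using assms by (auto simp: gaps_def intro!: coord_list_nth_less)

text \<open>The steps telescope. Neither \<open>x\<close> nor \<open>c\<close> has a sign
  restriction, so applying this to the negated sequence turns lower bounds on steps into lower
  bounds on differences.\<close>

lemma diff_le_of_steps:
  fixes x :: "nat \<Rightarrow> real"
  assumes "\<And>j. Suc j < m \<Longrightarrow> x (Suc j) - x j \<le> c" "j \<le> j'" "j' < m"
  shows "x j' - x j \<le> c * (real j' - real j)"
  using assms(2,3)
proof (induction j' rule: dec_induct)
  case (step k)
  then show ?case using assms(1)[of k] by (simp add: algebra_simps)
qed simp

section \<open>Lower bound: unions of open cubes\<close>

lemma emeasure_cube:
  fixes a :: "real ^ 'd::finite"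
  assumes "c \<ge> 0"
  shows "emeasure lborel (box a (\<chi> i. a $ i + c)) = ennreal (c ^ CARD('d))"
    and "emeasure lborel (cbox a (\<chi> i. a $ i + c)) = ennreal (c ^ CARD('d))"
proof -
  have *: "((\<chi> i. a $ i + c) - a) \<bullet> b = c" "a \<bullet> b \<le> (\<chi> i. a $ i + c) \<bullet> b"
    if "b \<in> Basis" for b
    using that assms by (auto simp: Basis_vec_def inner_axis)
  then have "(\<Prod>b\<in>Basis. ((\<chi> i. a $ i + c) - a) \<bullet> b) = c ^ CARD('d)"
    by simp
  with * show "emeasure lborel (box a (\<chi> i. a $ i + c)) = ennreal (c ^ CARD('d))"
    and "emeasure lborel (cbox a (\<chi> i. a $ i + c)) = ennreal (c ^ CARD('d))"
    by (simp_all add: emeasure_lborel_box emeasure_lborel_cbox)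
qed

text \<open>The side equals the lattice spacing and the cube is open: unions of cells are open, and
  distinct cells are disjoint because they share no boundary points.\<close>

definition cell :: "real \<Rightarrow> ('d \<Rightarrow> nat) \<Rightarrow> (real ^ 'd::finite) set" where
  "cell c k = box (\<chi> i. c * real (k i)) (\<chi> i. c * real (k i) + c)"

lemma cell_index:
  assumes "x \<in> cell c k" "c > 0"
  shows "nat \<lfloor>x $ i / c\<rfloor> = k i"
proof -
  have "c * real (k i) < x $ i" "x $ i < c * real (k i) + c"
    using assms(1) by (auto simp: cell_def mem_box_cart)
  then have "\<lfloor>x $ i / c\<rfloor> = int (k i)"
    using assms(2) by (simp add: floor_eq_iff field_simps)
  then show ?thesis by simp
qed

text \<open>The slab number of the image of the \<open>j\<close>-th coordinate serves as the
  selected index \<open>s i j\<close>. The map \<open>f\<close> never shrinks differences, so images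
  of distinct coordinates stay at least \<open>c\<close> apart and fall into different slabs of
  width \<open>c\<close>.\<close>

lemma cells_free:
  fixes P :: "(real ^ 'd::finite) set"
  assumes "finite P" and c: "0 < c" "\<And>i d. d \<in> set (gaps P i) \<Longrightarrow> c \<le> d"
    and A: "dims A = (\<lambda>i. n)" and cs: "contains_set (\<Union>k\<in>ones A. cell c k) P"
  shows "contains_matrix A (matrix_of P)"
proof -
  let ?S = "\<Union>k\<in>ones A. cell c k"
  from cs[unfolded contains_set_def] obtain f where
    f_in': "\<forall>i. \<forall>x\<in>coords i P. f i x \<in> coords i ?S"
    and f_exp': "\<forall>i. \<forall>x\<in>coords i P. \<forall>x'\<in>coords i P. x > x' \<longrightarrow> (f i x - f i x') / (x - x') \<ge> 1"
    and f_S': "\<forall>x\<in>P. (\<chi> i. f i (x $ i)) \<in> ?S" by blast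
  note f_in = f_in'[rule_format] and f_exp = f_exp'[rule_format] and f_S = f_S'[rule_format]
  define s where "s i j = nat \<lfloor>f i (coord_list i P ! j) / c\<rfloor>" for i j
  \<comment> \<open>Positivity matters because \<open>nat\<close> sends all negative floors to 0,
    which would destroy strict monotonicity of \<open>s\<close>.\<close>
  have pos_lt: "f i x > 0 \<and> nat \<lfloor>f i x / c\<rfloor> < n" if "x \<in> coords i P" for i x
  proof -
    from f_in[OF that] obtain y k where y: "f i x = y $ i" "k \<in> ones A" "y \<in> cell c k"
      by (auto simp: coords_def)
    then have "c * real (k i) < y $ i" by (auto simp: cell_def mem_box_cart)
    moreover have "0 \<le> c * real (k i)" using c by simp
    ultimately have "y $ i > 0" by linarith
    then show ?thesis using y cell_index[OF y(3) c(1), of i] ones_subset_box[OF A] by auto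
  qed
  have "s i j < s i j'" if jj: "j < j'" "j' < card (coords i P)" for i j j'
  proof -
    let ?x = "\<lambda>j. coord_list i P ! j"
    \<comment> \<open>Negating the coordinates turns the lower bound \<open>c\<close> on each gap
      into the upper bound that the telescoping lemma expects.\<close>
    have "(- ?x j') - (- ?x j) \<le> (- c) * (real j' - real j)"
      by (rule diff_le_of_steps[where m = "card (coords i P)" and x = "\<lambda>j. - ?x j"])
        (use jj c(2)[OF coord_list_diff_in_gaps] in force)+
    moreover have "c * 1 \<le> c * (real j' - real j)"
      using c jj by (intro mult_left_mono) auto
    ultimately have "c \<le> ?x j' - ?x j" by simp
    moreover have "1 \<le> (f i (?x j') - f i (?x j)) / (?x j' - ?x j)"
      using jj by (intro f_exp coord_list_nth coord_list_nth_less assms(1)) auto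
    ultimately have "c \<le> f i (?x j') - f i (?x j)"
      using c by (simp add: le_divide_eq split: if_splits)
    then have "f i (?x j) / c + 1 \<le> f i (?x j') / c"
      using c by (simp add: pos_le_divide_eq distrib_right)
    then have "\<lfloor>f i (?x j) / c\<rfloor> < \<lfloor>f i (?x j') / c\<rfloor>"
      by linarith
    moreover have "0 \<le> \<lfloor>f i (?x j) / c\<rfloor>"
      using pos_lt[OF coord_list_nth[OF assms(1)], of j i] jj c by simp
    ultimately show ?thesis unfolding s_def by linarith
  qed
  then have mono: "strict_mono_on {..<card (coords i P)} (s i)" for i
    by (auto simp: strict_mono_on_def)
  have range: "s i ` {..<card (coords i P)} \<subseteq> {..<n}" for i
    using pos_lt[OF coord_list_nth[OF assms(1)]] by (auto simp: s_def)
  have "entry A (\<lambda>i. s i (k i))" if k: "k \<in> ones (matrix_of P)" for k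
  proof -
    have "(\<chi> i. coord_list i P ! k i) \<in> P"
      using k by (simp add: ones_def matrix_of_def)
    from f_S[OF this] obtain k' where k': "k' \<in> ones A"
      "(\<chi> i. f i (coord_list i P ! k i)) \<in> cell c k'" by auto
    \<comment> \<open>The image point lies in the cell of a one of \<open>A\<close>, and any point
      of a cell determines the index of that cell.\<close>
    have "s i (k i) = k' i" for i
      using cell_index[OF k'(2) c(1), of i] by (simp add: s_def)
    then show ?thesis using k'(1) by (simp add: ones_def)
  qed
  with mono range show ?thesis
    unfolding contains_matrix_iff by (intro exI[of _ s]) (simp add: A matrix_of_def)
qed

text \<open>The union of cells over the ones of an extremal matrix is a competitor for
  \<open>opx\<close>; if \<open>ex\<close> is 0, the bound is trivial. The condition
  \<open>c \<le> 1\<close> keeps the cells inside the box of side \<open>n\<close>.\<close>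

lemma opx_lower:
  fixes P :: "(real ^ 'd::finite) set"
  assumes "finite P" and c: "0 < c" "c \<le> 1" "\<And>i d. d \<in> set (gaps P i) \<Longrightarrow> c \<le> d"
  shows "ennreal (c ^ CARD('d)) * of_nat (ex n (matrix_of P)) \<le> opx (real n) P"
proof (cases "ex n (matrix_of P) > 0")
  case True
  then obtain A where A: "dims A = (\<lambda>i. n)" "\<not> contains_matrix A (matrix_of P)"
    "card (ones A) = ex n (matrix_of P)" by (rule ex_attained)
  let ?S = "\<Union>k\<in>ones A. cell c k"
  have "disjoint_family_on (cell c :: _ \<Rightarrow> (real ^ 'd) set) (ones A)"
    unfolding disjoint_family_on_def using cell_index[OF _ c(1)] by (metis disjoint_iff ext)
  then have "emeasure lborel ?S = (\<Sum>k\<in>ones A. emeasure lborel (cell c k))"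
    by (intro sum_emeasure[symmetric] finite_ones[OF A(1)]) (auto simp: cell_def[abs_def] simp del: vec_lambda_beta)
  also have "\<dots> = (\<Sum>k\<in>ones A. ennreal (c ^ CARD('d)))"
    using c emeasure_cube(1)[of c "(\<chi> i. c * real (k i)) :: real ^ 'd" for k]
    by (simp add: cell_def)
  also have "\<dots> = ennreal (c ^ CARD('d)) * of_nat (ex n (matrix_of P))"
    by (simp add: A mult.commute)
  finally have meas: "emeasure lborel ?S = ennreal (c ^ CARD('d)) * of_nat (ex n (matrix_of P))" .
  have "open ?S" by (auto simp: cell_def)
  have "?S \<subseteq> cbox 0 (\<chi> i. real n)"
  proof
    fix x assume "x \<in> ?S"
    then obtain k where k: "k \<in> ones A" "x \<in> cell c k" by blast
    have "0 \<le> x $ i \<and> x $ i \<le> real n" for i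
    proof -
      have x: "c * real (k i) < x $ i" "x $ i < c * real (k i) + c"
        using k(2) by (auto simp: cell_def mem_box_cart)
      have "k i < n" using k(1) A(1) by (simp add: ones_def indices_def)
      then have "real (k i) + 1 \<le> real n" by linarith
      moreover have "c * (real (k i) + 1) \<le> 1 * (real (k i) + 1)"
        using c by (intro mult_right_mono) auto
      ultimately have "x $ i \<le> real n" using x by (simp add: distrib_left)
      moreover have "0 \<le> c * real (k i)" using c by simp
      then have "0 \<le> x $ i" using x(1) by linarith
      ultimately show ?thesis by simp
    qed
    then show "x \<in> cbox 0 (\<chi> i. real n)" by (simp add: mem_box_cart)
  qed
  moreover have "\<not> contains_set ?S P"
  proof
    assume "contains_set ?S P"
    with cells_free[OF assms(1) c(1) _ A(1)] c(3) have "contains_matrix A (matrix_of P)" by simp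
    with A(2) show False ..
  qed
  ultimately have "emeasure lebesgue ?S \<le> opx (real n) P"
    unfolding opx_def using \<open>open ?S\<close> by (intro SUP_upper) auto
  then show ?thesis using meas \<open>open ?S\<close> by simp
qed simp

section \<open>Upper bound: averaging over shifted lattices\<close>

text \<open>Passing to the next coordinate of \<open>P\<close> gains at most \<open>c\<close>, while
  the selected lattice coordinate gains at least \<open>c\<close>. Hence sending coordinates of
  \<open>P\<close> to lattice coordinates expands all differences.\<close>

lemma lattice_contains:
  fixes P :: "(real ^ 'd::finite) set"
  assumes "finite P" and c: "0 < c" "\<And>i d. d \<in> set (gaps P i) \<Longrightarrow> d \<le> c"
    and cm: "contains_matrix \<lparr>dims = D, entry = \<lambda>k. (\<chi> i. c * real (k i)) + t \<in> S\<rparr> (matrix_of P)"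
  shows "contains_set S P"
proof -
  from cm[unfolded contains_matrix_iff] obtain s where
    mono': "\<forall>i. strict_mono_on {..<card (coords i P)} (s i)"
    and ent': "\<forall>k\<in>ones (matrix_of P). (\<chi> i. c * real (s i (k i))) + t \<in> S"
    unfolding matrix_of_def by fastforce
  note mono = mono'[rule_format] and ent = ent'[rule_format]
  define idx where "idx i = inv_into {..<card (coords i P)} ((!) (coord_list i P))" for i
  have idx: "idx i x < card (coords i P)" "coord_list i P ! idx i x = x"
    if "x \<in> coords i P" for i x
    using coord_list_inv[OF assms(1) that] by (simp_all add: idx_def)
  \<comment> \<open>A coordinate goes to its rank in the sorted list, then to the selected matrix
    index, then to the shifted lattice coordinate.\<close>
  define f where "f i x = c * real (s i (idx i x)) + t $ i" for i x
  have f_S: "(\<chi> i. f i (x $ i)) \<in> S" if "x \<in> P" for x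
  proof -
    have xi: "x $ i \<in> coords i P" for i using that by (auto simp: coords_def)
    have "(\<lambda>i. idx i (x $ i)) \<in> ones (matrix_of P)"
      using idx[OF xi] that by (simp add: ones_def indices_def matrix_of_def)
    from ent[OF this] show ?thesis by (simp add: f_def plus_vec_def)
  qed
  have f_in: "f i x \<in> coords i S" if x: "x \<in> coords i P" for i x
  proof -
    from x obtain p where p: "p \<in> P" "x = p $ i" by (auto simp: coords_def)
    have "(\<chi> i. f i (p $ i)) $ i \<in> coords i S"
      unfolding coords_def using f_S[OF p(1)] by (rule imageI)
    then show ?thesis by (simp only: p(2) vec_lambda_beta)
  qed
  have f_exp: "(f i x - f i x') / (x - x') \<ge> 1"
    if x: "x \<in> coords i P" "x' \<in> coords i P" "x > x'" for i x x'
  proof -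
    let ?m = "card (coords i P)" and ?j = "idx i x" and ?j' = "idx i x'"
    have lt: "?j' < ?j"
    proof (rule linorder_cases[of ?j ?j'])
      assume "?j < ?j'"
      from coord_list_nth_less[OF this idx(1)[OF x(2)]] have "x < x'"
        by (simp only: idx(2)[OF x(1)] idx(2)[OF x(2)])
      with x(3) show ?thesis by simp
    next
      assume "?j = ?j'"
      then have "x = x'" using idx(2)[OF x(1)] idx(2)[OF x(2)] by metis
      with x(3) show ?thesis by simp
    qed
    have "coord_list i P ! ?j - coord_list i P ! ?j' \<le> c * (real ?j - real ?j')"
    proof (rule diff_le_of_steps[where m = ?m and x = "\<lambda>j. coord_list i P ! j"])
      fix j assume "Suc j < ?m"
      then show "coord_list i P ! Suc j - coord_list i P ! j \<le> c"
        by (rule c(2)[OF coord_list_diff_in_gaps])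
    qed (rule less_imp_le[OF lt], rule idx(1)[OF x(1)])
    then have "x - x' \<le> c * (real ?j - real ?j')"
      by (simp only: idx(2)[OF x(1)] idx(2)[OF x(2)])
    \<comment> \<open>A strictly increasing sequence of naturals grows by at least 1 per step; the
      signs are again flipped for the telescoping lemma.\<close>
    moreover have "(- real (s i ?j)) - (- real (s i ?j')) \<le> (- 1) * (real ?j - real ?j')"
    proof (rule diff_le_of_steps[where m = ?m and x = "\<lambda>j. - real (s i j)"])
      fix j assume "Suc j < ?m"
      then have "s i j < s i (Suc j)"
        using mono[of i] by (auto simp: strict_mono_on_def)
      then show "- real (s i (Suc j)) - - real (s i j) \<le> - 1" by linarith
    qed (rule less_imp_le[OF lt], rule idx(1)[OF x(1)])
    then have "c * (real ?j - real ?j') \<le> c * (real (s i ?j) - real (s i ?j'))"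
      using c by (intro mult_left_mono) auto
    ultimately have "x - x' \<le> f i x - f i x'"
      by (simp add: f_def algebra_simps)
    then show ?thesis using x(3) by simp
  qed
  show ?thesis
    unfolding contains_set_def using f_in f_exp f_S by blast
qed

text \<open>Cut \<open>S\<close> along the lattice cubes and translate every piece back to the base
  cube \<open>C\<close>. A point \<open>t\<close> of \<open>C\<close> is covered once for each
  lattice point of shift \<open>t\<close> in \<open>S\<close>, so at most \<open>N\<close> times;
  integrating this count over \<open>C\<close> gives the bound.\<close>

lemma emeasure_le_lattice_count:
  fixes S :: "(real ^ 'd::finite) set"
  assumes S: "S \<in> sets borel" "S \<subseteq> cbox 0 (\<chi> i. c * real n)" and c: "0 < c" and n: "0 < n"
    and N: "\<And>t. card {k. (\<forall>i. k i < n) \<and> (\<chi> i. c * real (k i)) + t \<in> S} \<le> N"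
  shows "emeasure lborel S \<le> ennreal (c ^ CARD('d)) * of_nat N"
proof -
  define K where "K = {k :: 'd \<Rightarrow> nat. \<forall>i. k i < n}"
  define v where "v k = (\<chi> i. c * real (k i))" for k :: "'d \<Rightarrow> nat"
  define C :: "(real ^ 'd) set" where "C = cbox 0 (\<chi> i. c)"
  define T where "T k = {t \<in> C. v k + t \<in> S}" for k
  have K: "finite K" unfolding K_def by (rule finite_box_indices)
  have T_sets: "T k \<in> sets borel" for k
  proof -
    have "(\<lambda>t. v k + t) -` S \<inter> space borel \<in> sets borel"
      by (rule measurable_sets[OF _ S(1)]) simp
    then have "C \<inter> ((\<lambda>t. v k + t) -` S) \<in> sets borel"
      by (auto simp: C_def)
    moreover have "T k = C \<inter> ((\<lambda>t. v k + t) -` S)" by (auto simp: T_def)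
    ultimately show ?thesis by simp
  qed
  \<comment> \<open>This preimage is \<open>T k\<close> translated by \<open>v k\<close>, that is,
    the part of \<open>S\<close> in the closed cube with lower corner \<open>v k\<close>.\<close>
  have U_sets: "(+) (- v k) -` T k \<in> sets borel" for k
    using measurable_sets[OF _ T_sets, of "(+) (- v k)" borel k] by simp
  have U_meas: "emeasure lborel ((+) (- v k) -` T k) = emeasure lborel (T k)" for k
    using T_sets by (subst (2) lborel_distr_plus[of "- v k", symmetric]) (simp add: emeasure_distr)
  have "S \<subseteq> (\<Union>k\<in>K. (+) (- v k) -` T k)"
  proof
    fix x assume "x \<in> S"
    then have x: "0 \<le> x $ i" "x $ i \<le> c * real n" for i
      using S(2) by (auto simp: mem_box_cart subset_iff)
    \<comment> \<open>On the far face the floor would give the index \<open>n\<close>, which is out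
      of range, so the last closed interval is used there. Overlaps of the closed cubes do no harm,
      since only subadditivity is needed.\<close>
    have "\<exists>j<n. c * real j \<le> x $ i \<and> x $ i \<le> c * real j + c" for i
    proof (cases "x $ i = c * real n")
      case True
      have "c * real n = c * real (n - 1) + c"
        using n by (cases n) (auto simp: algebra_simps)
      with True n c show ?thesis by (intro exI[of _ "n - 1"]) auto
    next
      case False
      then have "x $ i / c < real n" using x[of i] c by (simp add: field_simps)
      moreover have "0 \<le> x $ i / c" using x[of i] c by simp
      ultimately have "nat \<lfloor>x $ i / c\<rfloor> < n" "real (nat \<lfloor>x $ i / c\<rfloor>) \<le> x $ i / c"
        "x $ i / c \<le> real (nat \<lfloor>x $ i / c\<rfloor>) + 1"
        by linarith+
      then show ?thesis using c
        by (intro exI[of _ "nat \<lfloor>x $ i / c\<rfloor>"])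
          (auto simp only: pos_le_divide_eq pos_divide_le_eq distrib_right mult.commute[of c] mult_1)
    qed
    then obtain k where k: "\<And>i. k i < n" "\<And>i. c * real (k i) \<le> x $ i"
      "\<And>i. x $ i \<le> c * real (k i) + c" by metis
    have "- v k + x \<in> T k"
      using k \<open>x \<in> S\<close> by (auto simp: T_def C_def v_def mem_box_cart algebra_simps)
    moreover have "k \<in> K" using k by (simp add: K_def)
    ultimately show "x \<in> (\<Union>k\<in>K. (+) (- v k) -` T k)" by blast
  qed
  then have "emeasure lborel S \<le> emeasure lborel (\<Union>k\<in>K. (+) (- v k) -` T k)"
    using K U_sets by (intro emeasure_mono) auto
  also have "\<dots> \<le> (\<Sum>k\<in>K. emeasure lborel ((+) (- v k) -` T k))"
    using K U_sets by (intro emeasure_subadditive_finite) auto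
  also have "\<dots> = (\<Sum>k\<in>K. emeasure lborel (T k))"
    by (simp only: U_meas)
  also have "\<dots> = (\<integral>\<^sup>+t. (\<Sum>k\<in>K. indicator (T k) t) \<partial>lborel)"
    using T_sets by (subst nn_integral_sum) auto
  also have "\<dots> \<le> (\<integral>\<^sup>+t. of_nat N * indicator C t \<partial>lborel)"
  proof (rule nn_integral_mono)
    fix t
    show "(\<Sum>k\<in>K. indicator (T k) t) \<le> of_nat N * (indicator C t :: ennreal)"
    proof (cases "t \<in> C")
      case True
      have "(\<Sum>k\<in>K. indicator (T k) t :: ennreal) = (\<Sum>k\<in>{k\<in>K. v k + t \<in> S}. 1)"
        using K True by (intro sum.mono_neutral_cong_right) (auto simp: T_def)
      also have "\<dots> = of_nat (card {k\<in>K. v k + t \<in> S})" by simp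
      also have "\<dots> \<le> of_nat N"
        using N[of t] by (simp add: K_def v_def)
      finally show ?thesis using True by simp
    qed (simp add: T_def)
  qed
  also have "\<dots> = of_nat N * emeasure lborel C"
    by (subst nn_integral_cmult) (auto simp: C_def)
  also have "emeasure lborel C = ennreal (c ^ CARD('d))"
    using emeasure_cube(2)[of c "0 :: real ^ 'd"] c by (simp add: C_def)
  finally show ?thesis by (simp add: mult.commute)
qed

text \<open>Since \<open>1 \<le> c\<close>, the box of side \<open>n\<close> lies in the box of side
  \<open>c * n\<close>, which \<open>n\<close> lattice cubes in each direction cover. So every shift
  gives a matrix of side exactly \<open>n\<close>, and the count is bounded by \<open>ex\<close> at
  the same \<open>n\<close>.\<close>

lemma opx_upper:
  fixes P :: "(real ^ 'd::finite) set"
  assumes "finite P" and n: "0 < n" and c: "1 \<le> c" "\<And>i d. d \<in> set (gaps P i) \<Longrightarrow> d \<le> c"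
  shows "opx (real n) P \<le> ennreal (c ^ CARD('d)) * of_nat (ex n (matrix_of P))"
  unfolding opx_def
proof (rule SUP_least)
  fix S :: "(real ^ 'd) set"
  assume "S \<in> {S. open S \<and> S \<subseteq> cbox 0 (\<chi> i. real n) \<and> \<not> contains_set S P}"
  then have S: "open S" "S \<subseteq> cbox 0 (\<chi> i. real n)" "\<not> contains_set S P" by auto
  have "real n \<le> c * real n" using c(1) by (simp add: mult_le_cancel_right1)
  then have S_sub: "S \<subseteq> cbox 0 (\<chi> i. c * real n)"
    using S(2) by (auto simp: mem_box_cart subset_iff intro: order_trans)
  have "card {k. (\<forall>i. k i < n) \<and> (\<chi> i. c * real (k i)) + t \<in> S} \<le> ex n (matrix_of P)" for t
  proof -
    let ?A = "\<lparr>dims = \<lambda>i. n, entry = \<lambda>k. (\<chi> i. c * real (k i)) + t \<in> S\<rparr> :: 'd matrix01"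
    have "\<not> contains_matrix ?A (matrix_of P)"
      using lattice_contains[OF assms(1) _ c(2)] c(1) S(3) by force
    then have "card (ones ?A) \<le> ex n (matrix_of P)" by (intro card_ones_le_ex) simp
    then show ?thesis by (simp add: ones_def indices_def)
  qed
  then have "emeasure lborel S \<le> ennreal (c ^ CARD('d)) * of_nat (ex n (matrix_of P))"
    using S(1) S_sub n c(1) by (intro emeasure_le_lattice_count) auto
  then show "emeasure lebesgue S \<le> ennreal (c ^ CARD('d)) * of_nat (ex n (matrix_of P))"
    using S(1) by simp
qed

theorem theorem5p11:
  shows "\<exists>C1 C2 :: ('d::finite \<Rightarrow> real list) \<Rightarrow> real.
    \<forall>P :: (real ^ 'd) set. finite P \<longrightarrow>
      C1 (gaps P) > 0 \<and> C2 (gaps P) > 0 \<and>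
      (\<forall>\<^sub>F n :: nat in sequentially.
        ennreal (C1 (gaps P)) * of_nat (ex n (matrix_of P)) \<le> opx (real n) P \<and>
        opx (real n) P \<le> ennreal (C2 (gaps P)) * of_nat (ex n (matrix_of P)))"
proof -
  \<comment> \<open>The constants are functions of the gap lists alone. Inserting 1 makes the sets
    nonempty even when there are no gaps, and ensures \<open>c1 \<le> 1 \<le> c2\<close>.\<close>
  define c1 where "c1 g = Min (insert 1 (\<Union>i. set (g i)))" for g :: "'d \<Rightarrow> real list"
  define c2 where "c2 g = Max (insert 1 (\<Union>i. set (g i)))" for g :: "'d \<Rightarrow> real list"
  have c1: "0 < c1 (gaps P)" "c1 (gaps P) \<le> 1" "\<And>i d. d \<in> set (gaps P i) \<Longrightarrow> c1 (gaps P) \<le> d"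
    for P :: "(real ^ 'd) set"
    unfolding c1_def by (subst Min_gr_iff) (auto intro: Min_le gaps_pos)
  have c2: "1 \<le> c2 (gaps P)" "\<And>i d. d \<in> set (gaps P i) \<Longrightarrow> d \<le> c2 (gaps P)"
    for P :: "(real ^ 'd) set"
    unfolding c2_def by (auto intro: Max_ge)
  have "0 < c2 (gaps P)" for P :: "(real ^ 'd) set"
    using c2(1)[of P] by linarith
  \<comment> \<open>Both inequalities hold for every positive \<open>n\<close>, so 0 serves as the
    threshold.\<close>
  then show ?thesis
    using opx_lower[OF _ c1] opx_upper[OF _ _ c2] c1(1)
    by (intro exI[of _ "\<lambda>g. c1 g ^ CARD('d)"] exI[of _ "\<lambda>g. c2 g ^ CARD('d)"])
      (auto intro!: eventually_mono[OF eventually_gt_at_top[of 0]])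
qed

end
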